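(* Let $\Phi(\tau)=\int_0^\tau e^{-x^2/2}\,dx$ for $\tau\ge0$. For all $f\in\mathbb R$ and $\lambda>0$, $$\mathbb M_b(|f|,\lambda)=\mathbb M(f,|f|,\lambda)=\begin{cases}\dfrac{\Phi\big(|f|/\sqrt\lambda\big)}{\Phi(1)}, & |f|<\sqrt\lambda,\\[2mm] 1, & |f|\ge\sqrt\lambda,\end{cases}\ =\ \min\left(\frac{\Phi(|f|/\sqrt\lambda)}{\Phi(1)},\,1\right).$$
   Context: $\mathcal D$ denotes the standard collection of dyadic intervals of $\mathbb R$. For $I\in\mathcal D$, $I_-$ and $I_+$ are its left and right halves, $\mathbf 1_I$ its indicator function, and $|E|$ denotes Lebesgue measure. For integrable $\varphi$, $\langle\varphi\rangle_I=\frac1{|I|}\int_I\varphi\,dx$. Functions are real-valued. For $J\in\mathcal D$ the (localized) dyadic square function is given by $$S_J^2\varphi(x)=\sum_{I\in\mathcal D,\ I\subseteq J}|\Delta_I\varphi|^2\,\mathbf 1_I(x),\qquad \Delta_I\varphi=\tfrac12\big(\langle\varphi\rangle_{I_+}-\langle\varphi\rangle_{I_-}\big)\big(\mathbf 1_{I_+}-\mathbf 1_{I_-}\big).$$ For $f\in\mathbb R$, $F\ge|f|$, $\lambda>0$, $$\mathbb M(f,F,\lambda)=\sup\frac1{|J|}|\{x\in J:S_J^2\varphi(x)\ge\lambda\}|,$$ the supremum being over all integrable $\varphi$ supported in $J\in\mathcal D$ with $\langle\varphi\rangle_J=f$ and $\langle|\varphi|\rangle_J=F$; it does not depend on the choice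 of $J$. For $f\ge0$, $\lambda>0$, $\mathbb M_b(f,\lambda):=\mathbb M(f,|f|,\lambda)$, i.e. the supremum of $\frac1{|J|}|\{x\in J:S_J^2\varphi(x)\ge\lambda\}|$ over all $\varphi$ on $J$ with $\varphi\ge0$ a.e. and $\langle\varphi\rangle_J=f$. *)

theory Defs
  imports "HOL-Analysis.Analysis"
begin

text \<open>Dyadic intervals are taken half-open, so that \<open>I\<close> is the disjoint union of its two halves.\<close>

definition dyadic_interval :: "int \<Rightarrow> int \<Rightarrow> real set" where
  "dyadic_interval n k = {of_int k * 2 powi n ..< (of_int k + 1) * 2 powi n}"

definition dyadic_intervals :: "real set set" where
  "dyadic_intervals = {dyadic_interval n k | n k. True}"

definition left_half :: "real set \<Rightarrow> real set" where
  "left_half I = {Inf I ..< (Inf I + Sup I) / 2}"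

definition right_half :: "real set \<Rightarrow> real set" where
  "right_half I = {(Inf I + Sup I) / 2 ..< Sup I}"

definition average :: "real set \<Rightarrow> (real \<Rightarrow> real) \<Rightarrow> real" where
  "average I \<phi> = (LINT x:I|lebesgue. \<phi> x) / measure lebesgue I"

definition dyadic_diff :: "real set \<Rightarrow> (real \<Rightarrow> real) \<Rightarrow> real \<Rightarrow> real" where
  "dyadic_diff I \<phi> x =
     1/2 * (average (right_half I) \<phi> - average (left_half I) \<phi>)
         * (indicator (right_half I) x - indicator (left_half I) x)"

text \<open>The value is an extended nonnegative real: the series may diverge at some points, where a
  real-valued infinite sum would silently be \<open>0\<close>.\<close>

definition square_function_sq :: "real set \<Rightarrow> (real \<Rightarrow> real) \<Rightarrow> real \<Rightarrow> ennreal" where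
  "square_function_sq J \<phi> x =
     (\<Sum>\<^sub>\<infinity>I\<in>{I \<in> dyadic_intervals. I \<subseteq> J}. ennreal (\<bar>dyadic_diff I \<phi> x\<bar>\<^sup>2 * indicator I x))"

text \<open>The reference interval \<open>J\<close> is an explicit argument of the Bellman functions \<open>bellman_M\<close> and
  \<open>bellman_Mb\<close>; independence of \<open>J\<close> is not built into the definition.\<close>

definition admissible :: "real set \<Rightarrow> real \<Rightarrow> real \<Rightarrow> (real \<Rightarrow> real) set" where
  "admissible J f F = {\<phi>. integrable lebesgue \<phi> \<and> (\<forall>x. x \<notin> J \<longrightarrow> \<phi> x = 0) \<and>
     average J \<phi> = f \<and> average J (\<lambda>x. \<bar>\<phi> x\<bar>) = F}"

definition bellman_M :: "real set \<Rightarrow> real \<Rightarrow> real \<Rightarrow> real \<Rightarrow> real" where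
  "bellman_M J f F lam = (SUP \<phi>\<in>admissible J f F.
     measure lebesgue {x \<in> J. ennreal lam \<le> square_function_sq J \<phi> x} / measure lebesgue J)"

definition bellman_Mb :: "real set \<Rightarrow> real \<Rightarrow> real \<Rightarrow> real" where
  "bellman_Mb J f lam = bellman_M J f \<bar>f\<bar> lam"

definition Phi :: "real \<Rightarrow> real" where
  "Phi \<tau> = integral {0..\<tau>} (\<lambda>x. exp (- (x\<^sup>2) / 2))"

lemma Inf_Sup_dyadic_interval:
  "Inf (dyadic_interval n k) = of_int k * 2 powi n"
  "Sup (dyadic_interval n k) = (of_int k + 1) * 2 powi n"
  by (simp_all add: dyadic_interval_def)

lemma halves_dyadic_interval:
  "left_half (dyadic_interval n k) = dyadic_interval (n - 1) (2 * k)"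
  "right_half (dyadic_interval n k) = dyadic_interval (n - 1) (2 * k + 1)"
  unfolding left_half_def right_half_def Inf_Sup_dyadic_interval
  by (simp_all add: dyadic_interval_def power_int_diff add_divide_distrib algebra_simps)

lemma measure_dyadic_interval: "measure lebesgue (dyadic_interval n k) = 2 powi n"
  by (simp add: dyadic_interval_def algebra_simps)

text \<open>For \<open>f \<ge> 0\<close>, the class over which the supremum defining \<open>bellman_Mb\<close> is taken consists of the
  functions on \<open>J\<close> that are nonnegative a.e. and have average \<open>f\<close>.\<close>

lemma admissible_nonneg:
  assumes J: "J \<in> dyadic_intervals" and f: "f \<ge> 0"
  shows "admissible J f \<bar>f\<bar> = {\<phi>. integrable lebesgue \<phi> \<and> (\<forall>x. x \<notin> J \<longrightarrow> \<phi> x = 0) \<and>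
     (AE x in lebesgue. \<phi> x \<ge> 0) \<and> average J \<phi> = f}"
proof -
  obtain n k where Jnk: "J = dyadic_interval n k"
    using J by (auto simp: dyadic_intervals_def)
  have mJ: "measure lebesgue J > 0"
    by (simp add: Jnk measure_dyadic_interval)
  have "average J (\<lambda>x. \<bar>\<phi> x\<bar>) = average J \<phi> \<longleftrightarrow> (AE x in lebesgue. \<phi> x \<ge> 0)"
    if int: "integrable lebesgue \<phi>" and supp: "\<forall>x. x \<notin> J \<longrightarrow> \<phi> x = 0" for \<phi>
  proof -
    have "(\<lambda>x. indicator J x *\<^sub>R \<phi> x) = \<phi>" "(\<lambda>x. indicator J x *\<^sub>R \<bar>\<phi> x\<bar>) = (\<lambda>x. \<bar>\<phi> x\<bar>)"
      using supp by (auto simp: fun_eq_iff indicator_def)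
    then have "average J (\<lambda>x. \<bar>\<phi> x\<bar>) = average J \<phi> \<longleftrightarrow>
        (LINT x|lebesgue. \<bar>\<phi> x\<bar>) = (LINT x|lebesgue. \<phi> x)"
      using mJ by (simp add: average_def set_lebesgue_integral_def)
    also have "\<dots> \<longleftrightarrow> (LINT x|lebesgue. \<bar>\<phi> x\<bar> - \<phi> x) = 0"
      using int by (subst Bochner_Integration.integral_diff) auto
    also have "\<dots> \<longleftrightarrow> (AE x in lebesgue. \<bar>\<phi> x\<bar> - \<phi> x = 0)"
      using int by (intro integral_nonneg_eq_0_iff_AE) auto
    also have "\<dots> \<longleftrightarrow> (AE x in lebesgue. \<phi> x \<ge> 0)"
      by (intro AE_cong) auto
    finally show ?thesis .
  qed
  then show ?thesis
    using f by (auto simp: admissible_def)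
qed

end

theory Submission
  imports Defs
begin

text \<open>
  The averages of a nonnegative \<open>\<phi>\<close> over shrinking dyadic intervals form a martingale with
  symmetric steps: a step of size \<open>d\<close> moves \<open>(f, \<lambda>)\<close> to \<open>(f \<plusminus> d, \<lambda> - d\<^sup>2)\<close>. Put \<open>\<tau> = f / \<surd>\<lambda>\<close> and
  \<open>\<delta> = d / \<surd>\<lambda>\<close>, so that \<open>\<tau>\<close> moves to \<open>(\<tau> \<plusminus> \<delta>) / \<surd>(1 - \<delta>\<^sup>2)\<close>.

  Upper bound: for \<open>\<delta> \<le> \<tau> \<le> 1\<close> the average of \<open>\<Phi>\<close> over the two new points is at most \<open>\<Phi>(\<tau>)\<close>, so
  the candidate is a supersolution, and one iterates over the generations of \<open>J\<close>.

  Lower bound: the steps that keep \<open>\<delta>\<close> fixed are nearly optimal. Since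
  \<open>\<Phi>(\<tau> - \<delta>) + \<Phi>(\<tau> + \<delta>) \<ge> 2 \<Phi>(\<tau> \<surd>(1 - \<delta>\<^sup>2))\<close>, the function \<open>\<Phi>(\<surd>(1 - \<delta>\<^sup>2) y)\<close> is a subsolution for
  this step, and adding \<open>\<delta> y\<^sup>2\<close> makes it gain a fixed amount per step, so that finitely many
  steps suffice. A single doubling jump settles \<open>\<tau> \<ge> 1\<close>; finally \<open>\<delta> \<rightarrow> 0\<close>.
\<close>

subsection \<open>Step inequalities for the Gaussian integral\<close>

text \<open>\<open>{0..\<tau>}\<close> is empty for negative \<open>\<tau>\<close>, so
  \<open>Phi\<close> is 0 there and the two closed half-lines can be glued. Continuity on the whole
  line lets later limits be taken without sign conditions.\<close>

lemma continuous_on_Phi: "continuous_on UNIV Phi"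
proof -
  have "continuous_on {0..} Phi"
  proof -
    have "continuous_on {0..b} Phi" for b
      unfolding Phi_def[abs_def] by (intro indefinite_integral_continuous_1 integrable_continuous_real continuous_intros) auto
    then have "continuous (at x within {0..}) Phi" if "x \<ge> 0" for x
    proof -
      have "continuous (at x within {0..x+1}) Phi"
        using \<open>continuous_on {0..x+1} Phi\<close> that by (auto simp: continuous_on_eq_continuous_within)
      moreover have "at x within {0..x+1} = at x within {0..}"
        by (rule at_within_nhd[of _ "{..<x+1}"]) auto
      ultimately show ?thesis by simp
    qed
    then show ?thesis by (auto simp: continuous_on_eq_continuous_within)
  qed
  moreover have "continuous_on {..0} Phi"
  proof (rule continuous_on_eq[OF continuous_on_const])
    fix x :: real assume "x \<in> {..0}"
    then have "x < 0 \<or> x = 0" by auto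
    then show "0 = Phi x" by (auto simp: Phi_def)
  qed
  ultimately have "continuous_on ({0..} \<union> {..0}) Phi"
    by (intro continuous_on_closed_Un) auto
  moreover have "{0..} \<union> {..0} = (UNIV :: real set)" by auto
  ultimately show ?thesis by simp
qed

lemma continuous_on_Phi_comp [continuous_intros]:
  "continuous_on A g \<Longrightarrow> continuous_on A (\<lambda>x. Phi (g x))"
  using continuous_on_compose2[OF continuous_on_Phi] by blast

text \<open>\<open>Phi\<close> has a corner at 0, with one-sided slopes 0 and 1. The monotonicity
  arguments for \<open>Phi\<close> therefore use derivatives on open intervals only.\<close>

lemma DERIV_Phi:
  assumes "x > 0"
  shows "(Phi has_real_derivative exp (- (x\<^sup>2) / 2)) (at x)"
proof -
  have "(Phi has_real_derivative exp (- (x\<^sup>2) / 2)) (at x within {0..x+1})"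
    unfolding Phi_def[abs_def]
    by (rule integral_has_real_derivative) (use assms in \<open>auto intro!: continuous_intros\<close>)
  then show ?thesis using assms at_within_interior[of x "{0..x+1}"] by simp
qed

section \<open>Values and monotonicity of \<open>Phi\<close>\<close>

lemma Phi_0 [simp]: "Phi 0 = 0"
  by (simp add: Phi_def)

lemma Phi_strict_mono: "0 \<le> x \<Longrightarrow> x < y \<Longrightarrow> Phi x < Phi y"
  by (rule DERIV_pos_imp_increasing_open)
    (auto intro!: exI DERIV_Phi continuous_on_subset[OF continuous_on_Phi])

lemma Phi_mono: "0 \<le> x \<Longrightarrow> x \<le> y \<Longrightarrow> Phi x \<le> Phi y"
  using Phi_strict_mono[of x y] by (cases "x = y") auto

lemma Phi_pos: "0 < x \<Longrightarrow> 0 < Phi x"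
  using Phi_strict_mono[of 0 x] by simp

lemma Phi_nonneg: "0 \<le> x \<Longrightarrow> 0 \<le> Phi x"
  using Phi_mono[of 0 x] by simp

text \<open>The difference of the two sides vanishes at 1 and has derivative
  \<open>(t - 1)^2 / (2 * t^2)\<close>. At \<open>x = (1 + p) / (1 - p)\<close> the bound becomes
  \<open>2 * p / (1 - p^2)\<close>, the form needed in \<open>Phi_step_le\<close>.\<close>

lemma ln_le_half_diff_inverse:
  fixes x :: real
  assumes "1 \<le> x"
  shows "ln x \<le> (x - 1 / x) / 2"
proof -
  have "(\<lambda>x. (x - 1 / x) / 2 - ln x) 1 \<le> (\<lambda>x. (x - 1 / x) / 2 - ln x) x"
  proof (rule DERIV_nonneg_imp_nondecreasing[OF assms])
    fix t :: real assume t: "1 \<le> t" "t \<le> x"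
    have "((\<lambda>x. (x - 1 / x) / 2 - ln x) has_real_derivative ((t - 1)\<^sup>2 / (2 * t\<^sup>2))) (at t)"
      by (rule derivative_eq_intros refl | use t in \<open>simp add: field_simps power2_eq_square\<close>)+
    then show "\<exists>y. ((\<lambda>x. (x - 1 / x) / 2 - ln x) has_real_derivative y) (at t) \<and> 0 \<le> y"
      by (auto intro!: exI)
  qed
  then show ?thesis by simp
qed

text \<open>This is the product of \<open>tanh p \<le> p\<close> and
  \<open>cosh p \<le> exp (p^2 / 2)\<close>; the second follows from the first, because
  \<open>tanh\<close> is the logarithmic derivative of \<open>cosh\<close>.\<close>

lemma sinh_le_mult_exp:
  fixes p :: real
  assumes "0 \<le> p"
  shows "sinh p \<le> p * exp (p\<^sup>2 / 2)"
proof -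
  have tanh_le: "tanh t \<le> t" if "0 \<le> t" for t :: real
  proof -
    have "(\<lambda>x. x - tanh x) 0 \<le> (\<lambda>x. x - tanh x) t"
      by (rule DERIV_nonneg_imp_nondecreasing[OF that])
        (auto intro!: derivative_eq_intros exI)
    then show ?thesis by simp
  qed
  have "(\<lambda>x. x\<^sup>2 / 2 - ln (cosh x)) 0 \<le> (\<lambda>x. x\<^sup>2 / 2 - ln (cosh x)) p"
  proof (rule DERIV_nonneg_imp_nondecreasing[OF assms])
    fix t assume t: "0 \<le> t" "t \<le> p"
    have "((\<lambda>x::real. x\<^sup>2 / 2 - ln (cosh x)) has_real_derivative t - tanh t) (at t)"
      by (auto intro!: derivative_eq_intros simp: tanh_def field_simps)
    then show "\<exists>y. ((\<lambda>x. x\<^sup>2 / 2 - ln (cosh x)) has_real_derivative y) (at t) \<and> 0 \<le> y"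
      using tanh_le t by (auto intro!: exI)
  qed
  then have "cosh p \<le> exp (p\<^sup>2 / 2)"
    by (metis cosh_real_pos diff_ge_0_iff_ge exp_le_cancel_iff exp_ln cosh_0 ln_one diff_zero power_zero_numeral div_0)
  then have "tanh p * cosh p \<le> p * exp (p\<^sup>2 / 2)"
    using tanh_le[of p] assms by (intro mult_mono) auto
  then show ?thesis by (simp add: tanh_def)
qed

text \<open>Equality holds at \<open>d = 0\<close>, and the left side decreases as the step size
  \<open>u\<close> grows. With \<open>p = t * u\<close> and \<open>w = 1 - u^2\<close>, the sign of
  its derivative comes down to \<open>(1 + p) / (1 - p) \<le> exp (2 * p / w)\<close>.\<close>

lemma Phi_step_le:
  fixes t d :: real
  assumes "0 \<le> d" "d \<le> t" "t \<le> 1" "d < 1"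
  shows "Phi ((t - d) / sqrt (1 - d\<^sup>2)) + Phi ((t + d) / sqrt (1 - d\<^sup>2)) \<le> 2 * Phi t"
proof -
  define g where "g u = - Phi ((t - u) / sqrt (1 - u\<^sup>2)) - Phi ((t + u) / sqrt (1 - u\<^sup>2))" for u
  have sq: "u\<^sup>2 < 1" if "0 \<le> u" "u \<le> d" for u
    using that assms by (simp add: power2_less_1_iff)
  have "g 0 \<le> g d"
  proof (rule DERIV_nonneg_imp_increasing_open[OF assms(1)])
    fix u assume u: "0 < u" "u < d"
    define w where "w = 1 - u\<^sup>2"
    define s where "s = sqrt w"
    have w: "0 < w" using sq[of u] u by (simp add: w_def)
    have s: "0 < s" "s\<^sup>2 = w" using w by (auto simp: s_def)
    define p where "p = t * u"
    have p: "0 \<le> p" "p \<le> u" using u assms by (auto simp: p_def mult_left_le_one_le)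
    then have "p < 1" using u assms by simp
    note p = p this
    have ds: "((\<lambda>u. sqrt (1 - u\<^sup>2)) has_real_derivative (- u / s)) (at u)"
      using w by (auto intro!: derivative_eq_intros simp: w_def s_def field_simps)
    have dp: "((\<lambda>u. (t + u) / sqrt (1 - u\<^sup>2)) has_real_derivative ((1 + p) / (s * w))) (at u)"
    proof -
      have "((\<lambda>u. (t + u) / sqrt (1 - u\<^sup>2)) has_real_derivative ((0 + 1) * s - (t + u) * (- u / s)) / (s * s)) (at u)"
        using s unfolding s_def w_def
        by (intro DERIV_divide DERIV_add DERIV_const DERIV_ident ds[unfolded s_def w_def]) auto
      also have "((0 + 1) * s - (t + u) * (- u / s)) / (s * s) = (s\<^sup>2 + (t + u) * u) / (s * s\<^sup>2)"
        using s(1) by (simp add: field_simps power2_eq_square)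
      also have "\<dots> = (1 + p) / (s * w)" unfolding s(2) by (simp add: p_def w_def algebra_simps power2_eq_square)
      finally show ?thesis .
    qed
    have dm: "((\<lambda>u. (t - u) / sqrt (1 - u\<^sup>2)) has_real_derivative (- (1 - p) / (s * w))) (at u)"
    proof -
      have "((\<lambda>u. (t - u) / sqrt (1 - u\<^sup>2)) has_real_derivative ((0 - 1) * s - (t - u) * (- u / s)) / (s * s)) (at u)"
        using s unfolding s_def w_def
        by (intro DERIV_divide DERIV_diff DERIV_const DERIV_ident ds[unfolded s_def w_def]) auto
      also have "((0 - 1) * s - (t - u) * (- u / s)) / (s * s) = (- s\<^sup>2 + (t - u) * u) / (s * s\<^sup>2)"
        using s(1) by (simp add: field_simps power2_eq_square)
      also have "\<dots> = - (1 - p) / (s * w)" unfolding s(2) by (simp add: p_def w_def algebra_simps power2_eq_square)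
      finally show ?thesis .
    qed
    let ?em = "exp (- (((t - u) / s)\<^sup>2) / 2)" and ?ep = "exp (- (((t + u) / s)\<^sup>2) / 2)"
    have pos: "0 < (t - u) / s" "0 < (t + u) / s" using u assms s by auto
    have dg: "(g has_real_derivative - (?em * (- (1 - p) / (s * w))) - ?ep * ((1 + p) / (s * w))) (at u)"
      unfolding g_def
      using DERIV_chain2[OF DERIV_Phi[OF pos(1), unfolded s_def w_def] dm]
            DERIV_chain2[OF DERIV_Phi[OF pos(2), unfolded s_def w_def] dp]
      by (intro DERIV_diff DERIV_minus) (auto simp: s_def w_def)
    have "ln ((1 + p) / (1 - p)) \<le> ((1 + p) / (1 - p) - 1 / ((1 + p) / (1 - p))) / 2"
      using p by (intro ln_le_half_diff_inverse) (auto simp: field_simps)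
    also have "\<dots> = 2 * p / (1 - p\<^sup>2)"
    proof -
      have "1 - p\<^sup>2 = (1 - p) * (1 + p)" by (simp add: algebra_simps power2_eq_square)
      then show ?thesis using p by (simp add: divide_simps) (simp add: algebra_simps power2_eq_square)
    qed
    \<comment> \<open>Here \<open>t \<le> 1\<close> enters: it gives \<open>p \<le> u\<close>, hence
      \<open>1 - p^2 \<ge> w\<close>.\<close>
    also have "\<dots> \<le> 2 * p / w"
      using p u w unfolding w_def
      by (intro divide_left_mono mult_pos_pos) (auto intro!: power_mono simp: power2_less_1_iff)
    finally have "exp (ln ((1 + p) / (1 - p))) \<le> exp (2 * p / w)" by simp
    then have "(1 + p) / (1 - p) \<le> exp (2 * p / w)" using p by simp
    then have "1 + p \<le> (1 - p) * exp (2 * p / w)"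
      using p by (simp add: field_simps)
    then have "?ep * (1 + p) \<le> ?ep * ((1 - p) * exp (2 * p / w))" by simp
    also have "\<dots> = (1 - p) * (?ep * exp (2 * p / w))" by simp
    \<comment> \<open>The squares of \<open>t + u\<close> and \<open>t - u\<close> differ by
      \<open>4 * p\<close>, so the two Gaussian weights differ exactly by this exponential.\<close>
    also have "?ep * exp (2 * p / w) = ?em"
    proof -
      have "- (((t + u) / s)\<^sup>2) / 2 + 2 * p / w = - (((t - u) / s)\<^sup>2) / 2"
        using w unfolding power_divide s(2) by (simp add: p_def field_simps power2_eq_square)
      then show ?thesis by (simp add: exp_add[symmetric])
    qed
    finally have "(?ep * (1 + p)) / (s * w) \<le> ((1 - p) * ?em) / (s * w)"
      using s w by (intro divide_right_mono) auto
    then have "0 \<le> - (?em * (- (1 - p) / (s * w))) - ?ep * ((1 + p) / (s * w))"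
      by (simp add: mult.commute minus_divide_left[symmetric] del: minus_diff_eq)
    with dg show "\<exists>y. (g has_real_derivative y) (at u) \<and> 0 \<le> y" by blast
  next
    show "continuous_on {0..d} g"
    proof -
      have "sqrt (1 - u\<^sup>2) \<noteq> 0" if "u \<in> {0..d}" for u
        using sq[of u] that by auto
      then show ?thesis
        unfolding g_def by (intro continuous_intros) blast+
    qed
  qed
  then show ?thesis by (simp add: g_def)
qed

text \<open>Again by monotonicity in the step size \<open>u\<close>. Once the common Gaussian factor
  is removed, the derivative is nonnegative by \<open>sinh_le_mult_exp\<close> at
  \<open>p = t * u\<close>, weakened by \<open>1 / s\<close> and \<open>exp (u^2 / 2)\<close>, both
  at least 1.\<close>

lemma Phi_step_ge:
  fixes t d :: real
  assumes "0 \<le> d" "d \<le> t" "d < 1"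
  shows "2 * Phi (t * sqrt (1 - d\<^sup>2)) \<le> Phi (t - d) + Phi (t + d)"
proof -
  define g where "g u = Phi (t - u) + Phi (t + u) - 2 * Phi (t * sqrt (1 - u\<^sup>2))" for u
  have "g 0 \<le> g d"
  proof (rule DERIV_nonneg_imp_increasing_open[OF assms(1)])
    fix u assume u: "0 < u" "u < d"
    define w where "w = 1 - u\<^sup>2"
    define s where "s = sqrt w"
    have w: "0 < w" using u assms by (simp add: w_def power2_less_1_iff)
    have s: "0 < s" "s\<^sup>2 = w" "s \<le> 1" using w by (auto simp: s_def w_def)
    define p where "p = t * u"
    have p: "0 \<le> p" using u assms by (auto simp: p_def)
    have t: "0 < t" using u assms by simp
    have ds: "((\<lambda>u. t * sqrt (1 - u\<^sup>2)) has_real_derivative (- p / s)) (at u)"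
      using w by (auto intro!: derivative_eq_intros simp: w_def s_def field_simps p_def)
    let ?em = "exp (- ((t - u)\<^sup>2) / 2)" and ?ep = "exp (- ((t + u)\<^sup>2) / 2)" and ?es = "exp (- ((t * s)\<^sup>2) / 2)"
    have dm: "((\<lambda>u. Phi (t - u)) has_real_derivative ?em * (0 - 1)) (at u)"
      by (rule DERIV_chain2[OF DERIV_Phi]) (use u assms in \<open>auto intro!: derivative_eq_intros\<close>)
    have dp: "((\<lambda>u. Phi (t + u)) has_real_derivative ?ep * (0 + 1)) (at u)"
      by (rule DERIV_chain2[OF DERIV_Phi]) (use u assms in \<open>auto intro!: derivative_eq_intros\<close>)
    have dq: "((\<lambda>u. Phi (t * sqrt (1 - u\<^sup>2))) has_real_derivative ?es * (- p / s)) (at u)"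
      using DERIV_chain2[OF DERIV_Phi ds] t s by (simp add: s_def w_def)
    have dg: "(g has_real_derivative ?em * (0 - 1) + ?ep * (0 + 1) - 2 * (?es * (- p / s))) (at u)"
      unfolding g_def using dq by (intro DERIV_diff DERIV_add DERIV_cmult dm dp)
    let ?c = "exp (- (t\<^sup>2) / 2 - u\<^sup>2 / 2)"
    have em: "?em = ?c * exp p" and ep: "?ep = ?c * exp (- p)"
      and es: "?es = ?c * (exp (u\<^sup>2 / 2) * exp (p\<^sup>2 / 2))"
      unfolding exp_add[symmetric] power_mult_distrib s(2) p_def w_def
      by (simp_all add: field_simps power2_eq_square)
    have "sinh p \<le> p * exp (p\<^sup>2 / 2)" by (rule sinh_le_mult_exp[OF p])
    also have "\<dots> \<le> (p / s) * (exp (u\<^sup>2 / 2) * exp (p\<^sup>2 / 2))"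
    proof (intro mult_mono)
      show "p \<le> p / s" using p s by (simp add: field_simps mult_left_le)
      show "exp (p\<^sup>2 / 2) \<le> exp (u\<^sup>2 / 2) * exp (p\<^sup>2 / 2)" by simp
    qed (use p s in auto)
    finally have sinh_le: "sinh p \<le> (p / s) * (exp (u\<^sup>2 / 2) * exp (p\<^sup>2 / 2))" .
    have "?em * (0 - 1) + ?ep * (0 + 1) - 2 * (?es * (- p / s)) =
        ?c * (2 * ((p / s) * (exp (u\<^sup>2 / 2) * exp (p\<^sup>2 / 2)) - sinh p))"
      unfolding em ep es by (simp add: sinh_field_def algebra_simps diff_divide_distrib)
    also have "\<dots> \<ge> 0"
      using sinh_le by (intro mult_nonneg_nonneg) auto
    finally have "0 \<le> ?em * (0 - 1) + ?ep * (0 + 1) - 2 * (?es * (- p / s))" .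
    with dg show "\<exists>y. (g has_real_derivative y) (at u) \<and> 0 \<le> y" by blast
  next
    show "continuous_on {0..d} g"
      unfolding g_def by (intro continuous_intros)
  qed
  then show ?thesis by (simp add: g_def)
qed

subsection \<open>The dyadic square function as a series over generations\<close>

text \<open>The dyadic interval of length \<open>2 powi n\<close> that contains \<open>x\<close>;
  decreasing \<open>n\<close> gives the chain that shrinks to \<open>x\<close>.\<close>

definition level_interval :: "int \<Rightarrow> real \<Rightarrow> real set" where
  "level_interval n x = dyadic_interval n \<lfloor>x / 2 powi n\<rfloor>"

text \<open>The signed martingale step: the average moves by \<open>- osc\<close> on the left half
  and by \<open>+ osc\<close> on the right half, and \<open>dyadic_diff\<close> has modulus
  \<open>\<bar>osc\<bar>\<close> on the whole interval.\<close>

definition osc :: "(real \<Rightarrow> real) \<Rightarrow> int \<Rightarrow> int \<Rightarrow> real" where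
  "osc \<phi> n k = (average (dyadic_interval (n - 1) (2 * k + 1)) \<phi> - average (dyadic_interval (n - 1) (2 * k)) \<phi>) / 2"

definition osc_at :: "(real \<Rightarrow> real) \<Rightarrow> int \<Rightarrow> real \<Rightarrow> real" where
  "osc_at \<phi> n x = osc \<phi> n \<lfloor>x / 2 powi n\<rfloor>"

text \<open>Membership becomes an equation for the index, so uniqueness and disjointness within a
  generation are immediate.\<close>

lemma mem_dyadic_interval: "x \<in> dyadic_interval n k \<longleftrightarrow> k = \<lfloor>x / 2 powi n\<rfloor>"
proof -
  have "(2::real) powi n > 0" by simp
  then have "x \<in> dyadic_interval n k \<longleftrightarrow> of_int k \<le> x / 2 powi n \<and> x / 2 powi n < of_int k + 1"
    by (auto simp: dyadic_interval_def field_simps)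
  also have "\<dots> \<longleftrightarrow> k = \<lfloor>x / 2 powi n\<rfloor>" by (metis floor_eq_iff)
  finally show ?thesis .
qed

lemma dyadic_interval_split:
  "dyadic_interval n k = dyadic_interval (n - 1) (2 * k) \<union> dyadic_interval (n - 1) (2 * k + 1)"
proof -
  have "(2::real) powi n = 2 * 2 powi (n - 1)" by (simp add: power_int_diff)
  moreover have "(0::real) < 2 powi (n - 1)" by simp
  ultimately show ?thesis by (auto simp: dyadic_interval_def algebra_simps)
qed

lemma dyadic_interval_disjoint: "k \<noteq> l \<Longrightarrow> dyadic_interval n k \<inter> dyadic_interval n l = {}"
  by (auto simp: mem_dyadic_interval)

lemma dyadic_interval_halves_disjoint:
  "dyadic_interval n (2 * k) \<inter> dyadic_interval n (2 * k + 1) = {}"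
  by (rule dyadic_interval_disjoint) simp

lemma sets_dyadic_interval [measurable, simp]: "dyadic_interval n k \<in> sets lebesgue"
  by (simp add: dyadic_interval_def)

lemma emeasure_dyadic_interval: "emeasure lebesgue (dyadic_interval n k) = ennreal (2 powi n)"
  by (simp add: dyadic_interval_def algebra_simps)

lemma dyadic_interval_fmeasurable [simp]: "dyadic_interval n k \<in> lmeasurable"
  by (rule fmeasurableI) (auto simp: emeasure_dyadic_interval)

lemma level_interval_subset:
  "level_interval (n - int i) x \<subseteq> level_interval n x"
proof (induction i)
  case (Suc i)
  let ?m = "n - int i"
  have "x \<in> dyadic_interval ?m \<lfloor>x / 2 powi ?m\<rfloor>" by (simp add: mem_dyadic_interval)
  then obtain l where l: "x \<in> dyadic_interval (?m - 1) l"
      "dyadic_interval (?m - 1) l \<subseteq> dyadic_interval ?m \<lfloor>x / 2 powi ?m\<rfloor>"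
    using dyadic_interval_split[of ?m "\<lfloor>x / 2 powi ?m\<rfloor>"] by blast
  then have "level_interval (?m - 1) x \<subseteq> level_interval ?m x"
    by (auto simp: level_interval_def mem_dyadic_interval)
  with Suc show ?case by (simp add: algebra_simps)
qed simp

text \<open>Only intervals containing \<open>x\<close> contribute, and the reference interval has
  exactly one such subinterval in each generation from \<open>N\<close> downwards.\<close>

lemma square_function_sq_eq_suminf:
  assumes x: "x \<in> dyadic_interval N k"
  shows "square_function_sq (dyadic_interval N k) \<phi> x = (\<Sum>i. ennreal ((osc_at \<phi> (N - int i) x)\<^sup>2))"
proof -
  let ?J = "dyadic_interval N k"
  let ?h = "\<lambda>i. level_interval (N - int i) x"
  have J: "?J = level_interval N x" using x by (simp add: level_interval_def mem_dyadic_interval)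
  \<comment> \<open>Different generations have different lengths.\<close>
  have inj: "inj_on ?h UNIV"
  proof
    fix i j :: nat assume "?h i = ?h j"
    then have "measure lebesgue (?h i) = measure lebesgue (?h j)" by simp
    then have "(2::real) powi (N - int i) = 2 powi (N - int j)"
      by (simp add: level_interval_def measure_dyadic_interval)
    then show "i = j"
      using power_int_strict_increasing[of "N - int i" "N - int j" "2::real"]
        power_int_strict_increasing[of "N - int j" "N - int i" "2::real"]
      by (cases "i < j"; cases "j < i") auto
  qed
  have diff: "\<bar>dyadic_diff (?h i) \<phi> x\<bar>\<^sup>2 * indicator (?h i) x = (osc_at \<phi> (N - int i) x)\<^sup>2" for i
  proof -
    define n where "n = N - int i"
    define l where "l = \<lfloor>x / 2 powi n\<rfloor>"
    have x: "x \<in> dyadic_interval n l" by (simp add: mem_dyadic_interval l_def)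
    then have "x \<in> dyadic_interval (n - 1) (2 * l) \<and> x \<notin> dyadic_interval (n - 1) (2 * l + 1) \<or>
               x \<notin> dyadic_interval (n - 1) (2 * l) \<and> x \<in> dyadic_interval (n - 1) (2 * l + 1)"
      using dyadic_interval_split[of n l] dyadic_interval_halves_disjoint[of "n - 1" l] by blast
    with x show ?thesis
      unfolding n_def[symmetric] level_interval_def osc_at_def l_def[symmetric]
      by (auto simp: dyadic_diff_def halves_dyadic_interval osc_def power2_eq_square)
  qed
  have "square_function_sq ?J \<phi> x = infsum (\<lambda>I. ennreal (\<bar>dyadic_diff I \<phi> x\<bar>\<^sup>2 * indicator I x)) (range ?h)"
    unfolding square_function_sq_def
  proof (rule infsum_cong_neutral)
    fix I assume I: "I \<in> range ?h - {I \<in> dyadic_intervals. I \<subseteq> ?J}"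
    have "?h i \<in> dyadic_intervals \<and> ?h i \<subseteq> ?J" for i
      unfolding J using level_interval_subset[of N i x] by (auto simp: dyadic_intervals_def level_interval_def)
    with I show "ennreal (\<bar>dyadic_diff I \<phi> x\<bar>\<^sup>2 * indicator I x) = 0" by blast
  next
    fix I assume I: "I \<in> {I \<in> dyadic_intervals. I \<subseteq> ?J} - range ?h"
    have "x \<notin> I"
    proof
      assume xI: "x \<in> I"
      obtain n l where nl: "I = dyadic_interval n l" using I by (auto simp: dyadic_intervals_def)
      have "measure lebesgue I \<le> measure lebesgue ?J"
        unfolding nl by (rule measure_mono_fmeasurable) (use I nl in auto)
      then have "n \<le> N"
        using power_int_strict_increasing[of N n "2::real"] by (force simp: nl measure_dyadic_interval)
      then have "I = ?h (nat (N - n))" using xI by (simp add: nl level_interval_def mem_dyadic_interval)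
      with I show False by blast
    qed
    then show "ennreal (\<bar>dyadic_diff I \<phi> x\<bar>\<^sup>2 * indicator I x) = 0" by simp
  qed simp
  also have "\<dots> = infsum (\<lambda>i. ennreal ((osc_at \<phi> (N - int i) x)\<^sup>2)) UNIV"
    by (subst infsum_reindex[OF inj]) (simp only: o_def diff)
  also have "\<dots> = (\<Sum>i. ennreal ((osc_at \<phi> (N - int i) x)\<^sup>2))"
    by (intro sums_unique has_sum_imp_sums has_sum_infsum nonneg_summable_on_complete) simp
  finally show ?thesis .
qed

text \<open>The value depends on \<open>x\<close> only through an integer-valued floor, so
  measurability comes from the discrete space of indices.\<close>

lemma measurable_osc_at [measurable]: "osc_at \<phi> n \<in> borel_measurable lebesgue"
proof -
  have "(\<lambda>x::real. \<lfloor>x / (2::real) powi n\<rfloor>) \<in> measurable borel (count_space UNIV)" by measurable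
  then have "(\<lambda>x::real. osc \<phi> n \<lfloor>x / 2 powi n\<rfloor>) \<in> borel_measurable borel" by measurable
  then have "osc_at \<phi> n \<in> borel_measurable lborel" unfolding osc_at_def[abs_def] by simp
  then show ?thesis by (rule measurable_completion)
qed

section \<open>Averages over the two halves of an interval\<close>

lemma average_split:
  assumes "integrable lebesgue \<phi>"
  shows "average (dyadic_interval n k) \<phi> =
    (average (dyadic_interval (n - 1) (2 * k)) \<phi> + average (dyadic_interval (n - 1) (2 * k + 1)) \<phi>) / 2"
proof -
  have int: "set_integrable lebesgue (dyadic_interval m l) \<phi>" for m l
    unfolding set_integrable_def using assms by (intro integrable_mult_indicator) auto
  have "(LINT x:dyadic_interval n k|lebesgue. \<phi> x) =
    (LINT x:dyadic_interval (n - 1) (2 * k)|lebesgue. \<phi> x) + (LINT x:dyadic_interval (n - 1) (2 * k + 1)|lebesgue. \<phi> x)"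
    unfolding dyadic_interval_split[of n k]
    by (rule set_integral_Un[OF dyadic_interval_halves_disjoint int int])
  then show ?thesis
    by (simp add: average_def measure_dyadic_interval power_int_diff field_simps)
qed

lemma average_halves:
  assumes "integrable lebesgue \<phi>"
  shows "average (dyadic_interval (n - 1) (2 * k)) \<phi> = average (dyadic_interval n k) \<phi> - osc \<phi> n k"
    and "average (dyadic_interval (n - 1) (2 * k + 1)) \<phi> = average (dyadic_interval n k) \<phi> + osc \<phi> n k"
  using average_split[OF assms, of n k] by (auto simp: osc_def field_simps)

lemma average_nonneg:
  assumes "AE x in lebesgue. 0 \<le> \<phi> x"
  shows "0 \<le> average I \<phi>"
proof -
  have "0 \<le> (LINT x:I|lebesgue. \<phi> x)"
    unfolding set_lebesgue_integral_def
    by (intro Bochner_Integration.integral_nonneg_AE eventually_mono[OF assms]) (auto simp: indicator_def)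
  then show ?thesis by (simp add: average_def)
qed

subsection \<open>The upper bound\<close>

text \<open>The root of a negative number is negative here, so for \<open>f \<ge> 0\<close> and
  \<open>lam \<le> 0\<close> the second branch applies: value 1, as is right for a target already
  met. Hence the recursion may pass to \<open>lam - d^2\<close> of any sign.\<close>

definition bellman_val :: "real \<Rightarrow> real \<Rightarrow> real" where
  "bellman_val f lam = (if f < sqrt lam then Phi (f / sqrt lam) / Phi 1 else 1)"

lemma less_sqrt_imp_pos:
  fixes f lam :: real
  assumes "0 \<le> f" "f < sqrt lam"
  shows "0 < lam"
proof -
  have "0 < sqrt lam" using assms by linarith
  then show ?thesis by simp
qed

lemma bellman_val_nonneg: "0 \<le> f \<Longrightarrow> 0 \<le> bellman_val f lam"
  using less_sqrt_imp_pos[of f lam] Phi_pos[of 1] by (auto simp: bellman_val_def intro!: divide_nonneg_pos Phi_nonneg)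

text \<open>Monotonicity of \<open>Phi\<close> decides which argument is smaller. The minimum bounds
  the value by either branch and is visibly continuous in \<open>lam\<close>.\<close>

lemma bellman_val_eq_min:
  assumes "0 \<le> f" "0 < lam"
  shows "bellman_val f lam = min (Phi (f / sqrt lam) / Phi 1) 1"
  using assms Phi_mono[of "f / sqrt lam" 1] Phi_mono[of 1 "f / sqrt lam"] Phi_pos[of 1]
  by (auto simp: bellman_val_def min_def field_simps)

text \<open>Rescaling by \<open>sqrt lam\<close> turns this into \<open>Phi_step_le\<close>; for
  \<open>f \<ge> sqrt lam\<close> it is only the bound by 1.\<close>

lemma bellman_val_midpoint:
  assumes "0 \<le> f - d" "0 \<le> f + d"
  shows "(bellman_val (f - d) (lam - d\<^sup>2) + bellman_val (f + d) (lam - d\<^sup>2)) / 2 \<le> bellman_val f lam"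
proof -
  have le1: "bellman_val g l \<le> 1" if "0 \<le> g" for g l
  proof (cases "g < sqrt l")
    case True
    then have "0 < l" using that by (rule less_sqrt_imp_pos[rotated])
    then show ?thesis using bellman_val_eq_min[OF that] by simp
  qed (simp add: bellman_val_def)
  \<comment> \<open>A negative \<open>d\<close> merely interchanges the two halves, so
    \<open>d \<ge> 0\<close> suffices.\<close>
  have *: "(bellman_val (f - d) (lam - d\<^sup>2) + bellman_val (f + d) (lam - d\<^sup>2)) / 2 \<le> bellman_val f lam"
    if d: "0 \<le> d" "d \<le> f" for d
  proof (cases "f < sqrt lam")
    case False
    then show ?thesis using le1[of "f - d" "lam - d\<^sup>2"] le1[of "f + d" "lam - d\<^sup>2"] d
      by (auto simp: bellman_val_def[of f])
  next
    case True
    define r where "r = sqrt lam"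
    have r: "0 < r" "lam = r\<^sup>2" 
    proof -
      show "0 < r" using True d unfolding r_def by linarith
      then show "lam = r\<^sup>2" by (simp add: r_def)
    qed
    define t where "t = f / r"
    define u where "u = d / r"
    have tu: "0 \<le> u" "u \<le> t" "t \<le> 1" "u < 1" using True d r by (auto simp: t_def u_def r_def[symmetric] field_simps)
    have fd: "f = r * t" "d = r * u" using r by (auto simp: t_def u_def)
    have u2: "0 < 1 - u\<^sup>2" using tu by (simp add: power2_less_1_iff)
    have lam': "lam - d\<^sup>2 = r\<^sup>2 * (1 - u\<^sup>2)" by (simp add: fd r(2) algebra_simps)
    then have pos: "0 < lam - d\<^sup>2" using r u2 by simp
    have sq: "sqrt (lam - d\<^sup>2) = r * sqrt (1 - u\<^sup>2)" unfolding lam' using r by (simp add: real_sqrt_mult)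
    \<comment> \<open>Only an inequality: the ratio for \<open>f + d\<close> may exceed 1, where
      \<open>bellman_val\<close> is cut off.\<close>
    have b: "bellman_val (f - d) (lam - d\<^sup>2) \<le> Phi ((f - d) / sqrt (lam - d\<^sup>2)) / Phi 1"
        "bellman_val (f + d) (lam - d\<^sup>2) \<le> Phi ((f + d) / sqrt (lam - d\<^sup>2)) / Phi 1"
      using bellman_val_eq_min[OF _ pos, of "f - d"] bellman_val_eq_min[OF _ pos, of "f + d"] d by simp_all
    have e: "(f - d) / sqrt (lam - d\<^sup>2) = (t - u) / sqrt (1 - u\<^sup>2)"
      "(f + d) / sqrt (lam - d\<^sup>2) = (t + u) / sqrt (1 - u\<^sup>2)"
      using r unfolding sq by (simp_all add: fd right_diff_distrib[symmetric] distrib_left[symmetric])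
    have "bellman_val (f - d) (lam - d\<^sup>2) + bellman_val (f + d) (lam - d\<^sup>2) \<le>
        (Phi ((t - u) / sqrt (1 - u\<^sup>2)) + Phi ((t + u) / sqrt (1 - u\<^sup>2))) / Phi 1"
      using add_mono[OF b] unfolding e by (simp add: add_divide_distrib[symmetric])
    also have "\<dots> \<le> 2 * Phi t / Phi 1"
      by (intro divide_right_mono Phi_step_le tu Phi_nonneg) auto
    also have "\<dots> = 2 * bellman_val f lam"
      using True by (simp add: bellman_val_def r_def t_def)
    finally show ?thesis by simp
  qed
  show ?thesis using *[of d] *[of "-d"] assms by (cases "0 \<le> d") (auto simp: add.commute)
qed

section \<open>Iteration over finitely many generations and passage to the limit\<close>

lemma sets_partial_square [measurable]:
  "{x \<in> dyadic_interval N k. lam \<le> (\<Sum>i<n. (osc_at \<phi> (N - int i) x)\<^sup>2)} \<in> sets lebesgue"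
proof -
  have "{x \<in> dyadic_interval N k. lam \<le> (\<Sum>i<n. (osc_at \<phi> (N - int i) x)\<^sup>2)} =
    dyadic_interval N k \<inter> {x \<in> space lebesgue. lam \<le> (\<Sum>i<n. (osc_at \<phi> (N - int i) x)\<^sup>2)}" by auto
  also have "\<dots> \<in> sets lebesgue" by measurable
  finally show ?thesis .
qed

text \<open>Induction on the number of generations: the first one uses up \<open>d^2\<close> of the
  target, the halves are handled with target \<open>lam - d^2\<close>, and
  \<open>bellman_val_midpoint\<close> recombines them.\<close>

lemma measure_partial_square_le:
  assumes int: "integrable lebesgue \<phi>" and nn: "AE x in lebesgue. 0 \<le> \<phi> x"
  shows "measure lebesgue {x \<in> dyadic_interval N k. lam \<le> (\<Sum>i<n. (osc_at \<phi> (N - int i) x)\<^sup>2)}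
    \<le> 2 powi N * bellman_val (average (dyadic_interval N k) \<phi>) lam"
proof (induction n arbitrary: N k lam)
  case 0
  have a: "0 \<le> average (dyadic_interval N k) \<phi>" by (rule average_nonneg[OF nn])
  show ?case
  \<comment> \<open>The empty sum is 0, so the set is the whole interval for
    \<open>lam \<le> 0\<close> and empty otherwise.\<close>
  proof (cases "lam \<le> 0")
    case True
    then have "\<not> average (dyadic_interval N k) \<phi> < sqrt lam"
      using less_sqrt_imp_pos[OF a] by fastforce
    with True show ?thesis by (simp add: bellman_val_def measure_dyadic_interval)
  next
    case False
    then show ?thesis using bellman_val_nonneg[OF a] by simp
  qed
next
  case (Suc n)
  let ?J = "dyadic_interval N k" and ?L = "dyadic_interval (N - 1) (2 * k)" and ?R = "dyadic_interval (N - 1) (2 * k + 1)"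
  let ?S = "\<lambda>n N x. \<Sum>i<n. (osc_at \<phi> (N - int i) x)\<^sup>2"
  define d where "d = osc \<phi> N k"
  define f where "f = average ?J \<phi>"
  have avg: "average ?L \<phi> = f - d" "average ?R \<phi> = f + d"
    using average_halves[OF int, of N k] by (auto simp: f_def d_def)
  have nonneg: "0 \<le> f - d" "0 \<le> f + d"
    using average_nonneg[OF nn] avg by metis+
  have S: "?S (Suc n) N x = d\<^sup>2 + ?S n (N - 1) x" if "x \<in> ?J" for x
  proof -
    have "osc_at \<phi> N x = d" using that by (simp add: osc_at_def mem_dyadic_interval d_def)
    moreover have "N - int (Suc i) = N - 1 - int i" for i by simp
    ultimately show ?thesis
      unfolding sum.lessThan_Suc_shift by (simp only: of_nat_0 diff_0_right o_def)
  qed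
  have "{x \<in> ?J. lam \<le> ?S (Suc n) N x} =
    {x \<in> ?L. lam - d\<^sup>2 \<le> ?S n (N - 1) x} \<union> {x \<in> ?R. lam - d\<^sup>2 \<le> ?S n (N - 1) x}" (is "_ = ?A \<union> ?B")
  proof (rule set_eqI)
    fix x
    have "x \<in> ?J \<longleftrightarrow> x \<in> ?L \<or> x \<in> ?R" using dyadic_interval_split[of N k] by blast
    moreover have "lam \<le> ?S (Suc n) N x \<longleftrightarrow> lam - d\<^sup>2 \<le> ?S n (N - 1) x" if "x \<in> ?J"
      unfolding S[OF that] by linarith
    ultimately show "x \<in> {x \<in> ?J. lam \<le> ?S (Suc n) N x} \<longleftrightarrow> x \<in> ?A \<union> ?B" by blast
  qed
  then have "measure lebesgue {x \<in> ?J. lam \<le> ?S (Suc n) N x} \<le> measure lebesgue ?A + measure lebesgue ?B"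
    by (simp only:) (intro measure_Un_le sets_partial_square)
  also have "\<dots> \<le> 2 powi (N - 1) * bellman_val (f - d) (lam - d\<^sup>2) + 2 powi (N - 1) * bellman_val (f + d) (lam - d\<^sup>2)"
    by (rule add_mono[OF Suc[where N = "N - 1" and k = "2 * k", unfolded avg]
      Suc[where N = "N - 1" and k = "2 * k + 1", unfolded avg]])
  also have "\<dots> = 2 powi N * ((bellman_val (f - d) (lam - d\<^sup>2) + bellman_val (f + d) (lam - d\<^sup>2)) / 2)"
    by (simp add: power_int_diff field_simps)
  also have "\<dots> \<le> 2 powi N * bellman_val f lam"
    by (intro mult_left_mono bellman_val_midpoint nonneg) auto
  finally show ?case by (simp add: f_def)
qed

lemma sets_square_function [measurable]:
  "{x \<in> dyadic_interval N k. lam \<le> square_function_sq (dyadic_interval N k) \<phi> x} \<in> sets lebesgue"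
proof -
  have "{x \<in> dyadic_interval N k. lam \<le> square_function_sq (dyadic_interval N k) \<phi> x} =
    dyadic_interval N k \<inter> {x \<in> space lebesgue. lam \<le> (\<Sum>i. ennreal ((osc_at \<phi> (N - int i) x)\<^sup>2))}"
    by (auto simp: square_function_sq_eq_suminf)
  also have "\<dots> \<in> sets lebesgue" by measurable
  finally show ?thesis .
qed

text \<open>The series may reach \<open>lam\<close> only in the limit, without any partial sum doing
  so. Hence partial sums are compared with a smaller level \<open>l\<close>, and then
  \<open>l\<close> tends to \<open>lam\<close> from the left.\<close>

lemma measure_square_function_le:
  assumes int: "integrable lebesgue \<phi>" and nn: "AE x in lebesgue. 0 \<le> \<phi> x" and lam: "0 < lam"
  shows "measure lebesgue {x \<in> dyadic_interval N k. ennreal lam \<le> square_function_sq (dyadic_interval N k) \<phi> x}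
    \<le> 2 powi N * bellman_val (average (dyadic_interval N k) \<phi>) lam" (is "measure _ ?A \<le> _")
proof -
  let ?J = "dyadic_interval N k"
  define f where "f = average ?J \<phi>"
  have f: "0 \<le> f" unfolding f_def by (rule average_nonneg[OF nn])
  let ?B = "\<lambda>l n. {x \<in> ?J. l \<le> (\<Sum>i<n. (osc_at \<phi> (N - int i) x)\<^sup>2)}"
  have less: "measure lebesgue ?A \<le> 2 powi N * bellman_val f l" if l: "0 < l" "l < lam" for l
  proof -
    have "?A \<subseteq> (\<Union>n. ?B l n)"
    proof
      fix x assume "x \<in> ?A"
      then have x: "x \<in> ?J" and S: "ennreal lam \<le> square_function_sq ?J \<phi> x" by simp_all
      have "ennreal l < ennreal lam" using l by (simp add: ennreal_less_iff)
      also have "\<dots> \<le> (\<Sum>i. ennreal ((osc_at \<phi> (N - int i) x)\<^sup>2))"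
        using S unfolding square_function_sq_eq_suminf[OF x] .
      finally have "ennreal l < (\<Sum>i. ennreal ((osc_at \<phi> (N - int i) x)\<^sup>2))" .
      then obtain n where "ennreal l < (\<Sum>i<n. ennreal ((osc_at \<phi> (N - int i) x)\<^sup>2))"
        by (auto simp: suminf_eq_SUP less_SUP_iff)
      then have "l \<le> (\<Sum>i<n. (osc_at \<phi> (N - int i) x)\<^sup>2)"
        using l by (simp add: sum_ennreal ennreal_less_iff)
      with x show "x \<in> (\<Union>n. ?B l n)" by auto
    qed
    moreover have UN: "(\<Union>n. ?B l n) \<in> lmeasurable"
      by (rule fmeasurableI2[OF dyadic_interval_fmeasurable[of N k]]) auto
    ultimately have "measure lebesgue ?A \<le> measure lebesgue (\<Union>n. ?B l n)"
      by (intro measure_mono_fmeasurable) auto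
    moreover have "(\<lambda>n. measure lebesgue (?B l n)) \<longlonglongrightarrow> measure lebesgue (\<Union>n. ?B l n)"
    proof (rule Lim_measure_incseq)
      have "(\<Sum>i<m. (osc_at \<phi> (N - int i) x)\<^sup>2) \<le> (\<Sum>i<n. (osc_at \<phi> (N - int i) x)\<^sup>2)" if "m \<le> n" for m n x
        using that by (intro sum_mono2) auto
      then have "?B l m \<subseteq> ?B l n" if "m \<le> n" for m n
        using that order_trans by blast
      then show "incseq (?B l)" by (simp add: incseq_def)
      show "emeasure lebesgue (\<Union>n. ?B l n) \<noteq> \<infinity>" using UN by (simp add: fmeasurable_def top.not_eq_extremum)
    qed auto
    moreover have "measure lebesgue (?B l n) \<le> 2 powi N * bellman_val f l" for n
      unfolding f_def by (rule measure_partial_square_le[OF int nn])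
    ultimately show ?thesis
      using LIMSEQ_le_const2[of "\<lambda>n. measure lebesgue (?B l n)" _ "2 powi N * bellman_val f l"] by fastforce
  qed
  \<comment> \<open>The bound is continuous in the level, so nothing is lost as \<open>l\<close>
    tends to \<open>lam\<close>.\<close>
  have "((\<lambda>l. 2 powi N * min (Phi (f / sqrt l) / Phi 1) 1) \<longlongrightarrow> 2 powi N * min (Phi (f / sqrt lam) / Phi 1) 1) (at lam)"
  proof -
    have "isCont Phi (f / sqrt lam)" using continuous_on_Phi by (simp add: continuous_on_eq_continuous_at)
    then have "((\<lambda>l. Phi (f / sqrt l)) \<longlongrightarrow> Phi (f / sqrt lam)) (at lam)"
      by (rule isCont_tendsto_compose) (use lam in \<open>auto intro!: tendsto_eq_intros\<close>)
    then show ?thesis using Phi_pos[of 1] by (auto intro!: tendsto_intros)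
  qed
  then have lim: "((\<lambda>l. 2 powi N * min (Phi (f / sqrt l) / Phi 1) 1) \<longlongrightarrow> 2 powi N * bellman_val f lam) (at_left lam)"
    unfolding bellman_val_eq_min[OF f lam] by (rule tendsto_mono[rotated]) (simp add: at_le)
  have ev: "eventually (\<lambda>l. measure lebesgue ?A \<le> 2 powi N * min (Phi (f / sqrt l) / Phi 1) 1) (at_left lam)"
    using eventually_at_left_real[OF lam]
  proof (rule eventually_mono)
    fix l assume "l \<in> {0<..<lam}"
    then show "measure lebesgue ?A \<le> 2 powi N * min (Phi (f / sqrt l) / Phi 1) 1"
      using less[of l] bellman_val_eq_min[OF f, of l] by simp
  qed
  show ?thesis
    unfolding f_def[symmetric] by (rule tendsto_lowerbound[OF lim ev]) simp
qed

subsection \<open>The lower bound\<close>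

lemma average_cong:
  assumes "\<And>x. x \<in> dyadic_interval n k \<Longrightarrow> \<phi> x = \<psi> x"
  shows "average (dyadic_interval n k) \<phi> = average (dyadic_interval n k) \<psi>"
proof -
  have "(LINT x:dyadic_interval n k|lebesgue. \<phi> x) = (LINT x:dyadic_interval n k|lebesgue. \<psi> x)"
    by (rule set_lebesgue_integral_cong) (use assms in auto)
  then show ?thesis by (simp add: average_def)
qed

text \<open>All intervals of generation at most \<open>N\<close> around \<open>x\<close> lie inside
  the given one, so their averages see only the values there.\<close>

lemma osc_at_cong:
  assumes x: "x \<in> dyadic_interval N k" and eq: "\<And>x. x \<in> dyadic_interval N k \<Longrightarrow> \<phi> x = \<psi> x"
  shows "osc_at \<phi> (N - int i) x = osc_at \<psi> (N - int i) x"
proof -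
  let ?n = "N - int i"
  define l where "l = \<lfloor>x / 2 powi ?n\<rfloor>"
  have "dyadic_interval ?n l \<subseteq> dyadic_interval N k"
    using level_interval_subset[of N i x] x by (simp add: level_interval_def mem_dyadic_interval l_def)
  then have "dyadic_interval (?n - 1) (2 * l) \<subseteq> dyadic_interval N k"
    "dyadic_interval (?n - 1) (2 * l + 1) \<subseteq> dyadic_interval N k"
    using dyadic_interval_split[of ?n l] by blast+
  note sub = this
  have "average (dyadic_interval (?n - 1) (2 * l)) \<phi> = average (dyadic_interval (?n - 1) (2 * l)) \<psi>"
    by (rule average_cong, rule eq, erule subsetD[OF sub(1)])
  moreover have "average (dyadic_interval (?n - 1) (2 * l + 1)) \<phi> = average (dyadic_interval (?n - 1) (2 * l + 1)) \<psi>"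
    by (rule average_cong, rule eq, erule subsetD[OF sub(2)])
  ultimately show ?thesis unfolding osc_at_def l_def[symmetric] osc_def by (simp only:)
qed

lemma square_function_sq_cong:
  assumes "x \<in> dyadic_interval N k" and "\<And>x. x \<in> dyadic_interval N k \<Longrightarrow> \<phi> x = \<psi> x"
  shows "square_function_sq (dyadic_interval N k) \<phi> x = square_function_sq (dyadic_interval N k) \<psi> x"
  unfolding square_function_sq_eq_suminf[OF assms(1)] by (simp only: osc_at_cong[OF assms])

lemma square_function_sq_half:
  assumes x: "x \<in> dyadic_interval N k" and x': "x \<in> dyadic_interval (N - 1) l"
  shows "square_function_sq (dyadic_interval N k) \<phi> x =
    ennreal ((osc \<phi> N k)\<^sup>2) + square_function_sq (dyadic_interval (N - 1) l) \<phi> x"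
proof -
  let ?a = "\<lambda>n. ennreal ((osc_at \<phi> n x)\<^sup>2)"
  have shift: "N - int (i + 1) = N - 1 - int i" for i by simp
  have "(\<Sum>i. ?a (N - int i)) = (\<Sum>i. ?a (N - int (i + 1))) + (\<Sum>i<1. ?a (N - int i))"
    by (rule suminf_offset) simp
  also have "(\<Sum>i<1. ?a (N - int i)) = ?a N" by simp
  finally have "(\<Sum>i. ?a (N - int i)) = (\<Sum>i. ?a (N - 1 - int i)) + ?a N"
    unfolding shift .
  moreover have "osc_at \<phi> N x = osc \<phi> N k" using x by (simp add: osc_at_def mem_dyadic_interval)
  ultimately show ?thesis
    unfolding square_function_sq_eq_suminf[OF x] square_function_sq_eq_suminf[OF x'] by (simp add: add.commute)
qed

text \<open>Quantifying over every dyadic interval allows the functions to be placed on either half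
  of a larger one. A target \<open>lam \<le> 0\<close> is permitted: \<open>ennreal\<close> sends it
  to 0, and the condition then holds everywhere.\<close>

definition attains :: "real \<Rightarrow> real \<Rightarrow> real \<Rightarrow> bool" where
  "attains f lam q \<longleftrightarrow> (\<forall>N k. \<exists>\<phi>. integrable lebesgue \<phi> \<and> (\<forall>x. 0 \<le> \<phi> x) \<and>
     (\<forall>x. x \<notin> dyadic_interval N k \<longrightarrow> \<phi> x = 0) \<and> average (dyadic_interval N k) \<phi> = f \<and>
     q * 2 powi N \<le> measure lebesgue {x \<in> dyadic_interval N k. ennreal lam \<le> square_function_sq (dyadic_interval N k) \<phi> x})"

lemma attainsE:
  assumes "attains f lam q"
  obtains \<phi> where "integrable lebesgue \<phi>" "\<forall>x. 0 \<le> \<phi> x" "\<forall>x. x \<notin> dyadic_interval N k \<longrightarrow> \<phi> x = 0"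
    "average (dyadic_interval N k) \<phi> = f"
    "q * 2 powi N \<le> measure lebesgue {x \<in> dyadic_interval N k. ennreal lam \<le> square_function_sq (dyadic_interval N k) \<phi> x}"
  using assms[unfolded attains_def, THEN spec, THEN spec, of N k] by (elim exE conjE)

lemma attains_mono:
  assumes "attains f lam q" "q' \<le> q"
  shows "attains f lam q'"
  unfolding attains_def
proof (intro allI)
  fix N k
  let ?J = "dyadic_interval N k"
  obtain \<phi> where \<phi>: "integrable lebesgue \<phi>" "\<forall>x. 0 \<le> \<phi> x" "\<forall>x. x \<notin> ?J \<longrightarrow> \<phi> x = 0" "average ?J \<phi> = f"
      "q * 2 powi N \<le> measure lebesgue {x \<in> ?J. ennreal lam \<le> square_function_sq ?J \<phi> x}"
    by (rule attainsE[OF assms(1)])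
  have "q' * 2 powi N \<le> q * 2 powi N" using assms(2) by (intro mult_right_mono) auto
  note le = order_trans[OF this \<phi>(5)]
  show "\<exists>\<phi>. integrable lebesgue \<phi> \<and> (\<forall>x. 0 \<le> \<phi> x) \<and> (\<forall>x. x \<notin> ?J \<longrightarrow> \<phi> x = 0) \<and> average ?J \<phi> = f \<and>
      q' * 2 powi N \<le> measure lebesgue {x \<in> ?J. ennreal lam \<le> square_function_sq ?J \<phi> x}"
    by (intro exI[of _ \<phi>] conjI \<phi>(1-4) le)
qed

text \<open>The constant function serves as the end of the construction: a nonpositive target is met
  everywhere, and for a positive one nothing is claimed.\<close>

lemma attains_const:
  assumes "0 \<le> f" "q \<le> (if lam \<le> 0 then 1 else 0)"
  shows "attains f lam q"
  unfolding attains_def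
proof (intro allI exI conjI impI)
  fix N k
  let ?J = "dyadic_interval N k"
  let ?\<phi> = "\<lambda>x. indicator ?J x * f"
  show "integrable lebesgue ?\<phi>" by (simp add: emeasure_dyadic_interval)
  have "average ?J ?\<phi> = average ?J (\<lambda>_. f)"
    by (rule average_cong) simp
  also have "\<dots> = f"
    by (simp add: average_def set_lebesgue_integral_def measure_dyadic_interval)
  finally show "average ?J ?\<phi> = f" .
  show "q * 2 powi N \<le> measure lebesgue {x \<in> ?J. ennreal lam \<le> square_function_sq ?J ?\<phi> x}"
  proof (cases "lam \<le> 0")
    case True
    then show ?thesis using assms(2) by (simp add: ennreal_neg measure_dyadic_interval)
  next
    case False
    then have "q * 2 powi N \<le> 0" using assms(2) by (simp add: mult_nonpos_nonneg)
    then show ?thesis by (rule order_trans[OF _ measure_nonneg])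
  qed
qed (use assms(1) in auto)

text \<open>Functions for the two halves are added. Their averages differ by \<open>2 * d\<close>,
  so the top interval contributes \<open>d^2\<close> at every point, on top of the square function
  of the half.\<close>

lemma attains_step:
  assumes "attains (f - d) (lam - d\<^sup>2) q" and "attains (f + d) (lam - d\<^sup>2) r"
  shows "attains f lam ((q + r) / 2)"
  unfolding attains_def
proof (intro allI)
  fix N k
  let ?J = "dyadic_interval N k" and ?L = "dyadic_interval (N - 1) (2 * k)" and ?R = "dyadic_interval (N - 1) (2 * k + 1)"
  let ?E = "\<lambda>I lam \<phi>. {x \<in> I. ennreal lam \<le> square_function_sq I \<phi> x}"
  obtain \<phi> where \<phi>: "integrable lebesgue \<phi>" "\<forall>x. 0 \<le> \<phi> x" "\<forall>x. x \<notin> ?L \<longrightarrow> \<phi> x = 0" "average ?L \<phi> = f - d"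
      "q * 2 powi (N - 1) \<le> measure lebesgue (?E ?L (lam - d\<^sup>2) \<phi>)"
    by (rule attainsE[OF assms(1)])
  obtain \<psi> where \<psi>: "integrable lebesgue \<psi>" "\<forall>x. 0 \<le> \<psi> x" "\<forall>x. x \<notin> ?R \<longrightarrow> \<psi> x = 0" "average ?R \<psi> = f + d"
      "r * 2 powi (N - 1) \<le> measure lebesgue (?E ?R (lam - d\<^sup>2) \<psi>)"
    by (rule attainsE[OF assms(2)])
  let ?\<xi> = "\<lambda>x. \<phi> x + \<psi> x"
  have L: "?\<xi> x = \<phi> x" if "x \<in> ?L" for x
    using that \<psi>(3)[rule_format, of x] dyadic_interval_halves_disjoint[of "N - 1" k] by auto
  have R: "?\<xi> x = \<psi> x" if "x \<in> ?R" for x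
    using that \<phi>(3)[rule_format, of x] dyadic_interval_halves_disjoint[of "N - 1" k] by auto
  have int: "integrable lebesgue ?\<xi>" using \<phi>(1) \<psi>(1) by simp
  have avg: "average ?L ?\<xi> = f - d" "average ?R ?\<xi> = f + d"
    by (rule average_cong[OF L, THEN trans, OF _ \<phi>(4)], assumption)
      (rule average_cong[OF R, THEN trans, OF _ \<psi>(4)], assumption)
  have osc: "osc ?\<xi> N k = d" by (simp add: osc_def avg)
  \<comment> \<open>For \<open>lam < d^2\<close> the remaining target truncates to 0, and
    \<open>d^2\<close> alone exceeds \<open>lam\<close>.\<close>
  have sub: "ennreal lam \<le> ennreal (d\<^sup>2) + S" if "ennreal (lam - d\<^sup>2) \<le> S" for S
  proof -
    have "ennreal lam \<le> ennreal (d\<^sup>2) + ennreal (lam - d\<^sup>2)"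
    proof (cases "d\<^sup>2 \<le> lam")
      case True
      then have "ennreal (d\<^sup>2 + (lam - d\<^sup>2)) = ennreal (d\<^sup>2) + ennreal (lam - d\<^sup>2)"
        by (intro ennreal_plus) auto
      then show ?thesis by simp
    next
      case False
      then show ?thesis by (simp add: ennreal_neg ennreal_leI)
    qed
    also have "\<dots> \<le> ennreal (d\<^sup>2) + S" using that by (intro add_left_mono)
    finally show ?thesis .
  qed
  have memJ: "x \<in> ?J" if "x \<in> ?L \<or> x \<in> ?R" for x using that dyadic_interval_split[of N k] by blast
  have EL: "?E ?L (lam - d\<^sup>2) \<phi> \<subseteq> ?E ?J lam ?\<xi>"
  proof
    fix x assume "x \<in> ?E ?L (lam - d\<^sup>2) \<phi>"
    then have x: "x \<in> ?L" "ennreal (lam - d\<^sup>2) \<le> square_function_sq ?L \<phi> x" by simp_all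
    have J: "x \<in> ?J" using x memJ by blast
    have "square_function_sq ?J ?\<xi> x = ennreal (d\<^sup>2) + square_function_sq ?L \<phi> x"
      using square_function_sq_half[OF J x(1), of ?\<xi>] square_function_sq_cong[OF x(1) L] osc by (simp only:)
    with sub[OF x(2)] J show "x \<in> ?E ?J lam ?\<xi>" by simp
  qed
  have ER: "?E ?R (lam - d\<^sup>2) \<psi> \<subseteq> ?E ?J lam ?\<xi>"
  proof
    fix x assume "x \<in> ?E ?R (lam - d\<^sup>2) \<psi>"
    then have x: "x \<in> ?R" "ennreal (lam - d\<^sup>2) \<le> square_function_sq ?R \<psi> x" by simp_all
    have J: "x \<in> ?J" using x memJ by blast
    have "square_function_sq ?J ?\<xi> x = ennreal (d\<^sup>2) + square_function_sq ?R \<psi> x"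
      using square_function_sq_half[OF J x(1), of ?\<xi>] square_function_sq_cong[OF x(1) R] osc by (simp only:)
    with sub[OF x(2)] J show "x \<in> ?E ?J lam ?\<xi>" by simp
  qed
  have fin: "?E (dyadic_interval n l) a \<theta> \<in> lmeasurable" for n l a \<theta>
    by (rule fmeasurableI2[OF dyadic_interval_fmeasurable[of n l] _ sets_square_function]) blast
  have "(q + r) / 2 * 2 powi N = q * 2 powi (N - 1) + r * 2 powi (N - 1)"
    by (simp add: power_int_diff field_simps)
  also have "\<dots> \<le> measure lebesgue (?E ?L (lam - d\<^sup>2) \<phi>) + measure lebesgue (?E ?R (lam - d\<^sup>2) \<psi>)"
    by (rule add_mono[OF \<phi>(5) \<psi>(5)])
  also have "\<dots> = measure lebesgue (?E ?L (lam - d\<^sup>2) \<phi> \<union> ?E ?R (lam - d\<^sup>2) \<psi>)"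
  proof (rule measure_Union[symmetric])
    show "?E ?L (lam - d\<^sup>2) \<phi> \<inter> ?E ?R (lam - d\<^sup>2) \<psi> = {}"
      using dyadic_interval_halves_disjoint[of "N - 1" k] by blast
  qed (simp_all only: fmeasurableD[OF fin] fmeasurableD2[OF fin] infinity_ennreal_def not_False_eq_True)
  also have "\<dots> \<le> measure lebesgue (?E ?J lam ?\<xi>)"
    by (rule measure_mono_fmeasurable[OF Un_least[OF EL ER] sets.Un[OF fmeasurableD[OF fin] fmeasurableD[OF fin]] fin])
  finally have le: "(q + r) / 2 * 2 powi N \<le> measure lebesgue (?E ?J lam ?\<xi>)" .
  have avgJ: "average ?J ?\<xi> = f" using average_split[OF int, of N k] avg by simp
  have zero: "?\<xi> x = 0" if "x \<notin> ?J" for x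
  proof -
    have "x \<notin> ?L" "x \<notin> ?R" using that memJ[of x] by blast+
    then show ?thesis using \<phi>(3) \<psi>(3) by simp
  qed
  have nonneg: "0 \<le> ?\<xi> x" for x using \<phi>(2) \<psi>(2) by simp
  show "\<exists>\<phi>. integrable lebesgue \<phi> \<and> (\<forall>x. 0 \<le> \<phi> x) \<and>
     (\<forall>x. x \<notin> ?J \<longrightarrow> \<phi> x = 0) \<and> average ?J \<phi> = f \<and> (q + r) / 2 * 2 powi N \<le> measure lebesgue (?E ?J lam \<phi>)"
    by (rule exI[of _ ?\<xi>], intro conjI allI impI) (rule int nonneg avgJ le | erule zero)+
qed

text \<open>The doubling jump, with \<open>d = f\<close>: the averages become 0 and
  \<open>2 * f\<close>, and the remaining target is nonpositive.\<close>

lemma attains_1: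
  assumes "0 \<le> f" "lam \<le> f\<^sup>2"
  shows "attains f lam 1"
proof -
  have "attains (f - f) (lam - f\<^sup>2) 1"
    by (rule attains_const) (use assms in simp_all)
  moreover have "attains (f + f) (lam - f\<^sup>2) 1"
    by (rule attains_const) (use assms in simp_all)
  ultimately have "attains f lam ((1 + 1) / 2)" by (rule attains_step)
  then show ?thesis by simp
qed

text \<open>\<open>H\<close> is the perturbed subsolution, normalized to 1 at the largest ratio that
  one step from below 1 can reach. The subtracted \<open>H \<delta>\<close> is the loss from
  stopping once the ratio is too small for another step.\<close>

lemma attains_discrete:
  fixes \<delta> f lam :: real
  defines "s \<equiv> sqrt (1 - \<delta>\<^sup>2)"
  defines "h \<equiv> \<lambda>y. Phi (s * y) + \<delta> * y\<^sup>2"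
  defines "H \<equiv> \<lambda>y. h y / h ((1 + \<delta>) / s)"
  assumes \<delta>: "0 < \<delta>" "\<delta> < 1" and f: "0 \<le> f" "f < sqrt lam"
  shows "attains f lam (H (f / sqrt lam) - H \<delta>)"
proof -
  define Y where "Y = (1 + \<delta>) / s"
  have \<delta>2: "0 < 1 - \<delta>\<^sup>2" using \<delta> by (simp add: power2_less_1_iff)
  have s: "0 < s" "s\<^sup>2 = 1 - \<delta>\<^sup>2" "s \<le> 1" using \<delta>2 by (auto simp: s_def)
  have Y: "1 < Y" using s \<delta> by (simp add: Y_def)
  have h_mono: "h x \<le> h y" if "0 \<le> x" "x \<le> y" for x y
    unfolding h_def using that s \<delta> by (intro add_mono mult_left_mono power_mono Phi_mono) auto
  have hY: "0 < h Y" unfolding h_def using Y s \<delta> by (intro add_pos_pos Phi_pos) auto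
  have H: "H y = h y / h Y" for y by (simp add: H_def Y_def)
  have H_mono: "H x \<le> H y" if "0 \<le> x" "x \<le> y" for x y
    unfolding H using h_mono[OF that] hY by (simp add: divide_right_mono)
  have H_0: "0 \<le> H y" if "0 \<le> y" for y using H_mono[OF _ that] by (simp add: H h_def)
  have H_1: "H y \<le> 1" if "0 \<le> y" "y \<le> Y" for y using H_mono[OF that] hY by (simp add: H)
  \<comment> \<open>The gain per step: the quadratic term raises the mean of \<open>h\<close> by at
    least \<open>\<delta> * (\<delta>^2 / s^2)\<close>, here divided by \<open>h Y\<close>.\<close>
  define \<kappa> where "\<kappa> = \<delta> * (\<delta>\<^sup>2 / s\<^sup>2) / h Y"
  have \<kappa>: "0 < \<kappa>" using \<delta> s(1) hY unfolding \<kappa>_def by (intro divide_pos_pos mult_pos_pos zero_less_power)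
  have gain: "H t + \<kappa> \<le> (H ((t - \<delta>) / s) + H ((t + \<delta>) / s)) / 2" if t: "\<delta> \<le> t" for t
  proof -
    define u v where "u = (t - \<delta>) / s" and "v = (t + \<delta>) / s"
    define c where "c = \<delta>\<^sup>2 / s\<^sup>2"
    have "u\<^sup>2 + v\<^sup>2 = 2 * ((t\<^sup>2 + \<delta>\<^sup>2) / s\<^sup>2)"
      unfolding u_def v_def
      by (simp add: power_divide add_divide_distrib[symmetric]) (simp add: power2_eq_square algebra_simps)
    also have "(t\<^sup>2 + \<delta>\<^sup>2) / s\<^sup>2 = t\<^sup>2 + c + t\<^sup>2 * \<delta>\<^sup>2 / s\<^sup>2"
      using \<delta>2 unfolding c_def s(2) by (simp add: divide_simps) (simp add: algebra_simps)
    finally have "2 * (t\<^sup>2 + c) \<le> u\<^sup>2 + v\<^sup>2" by simp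
    then have "\<delta> * (2 * (t\<^sup>2 + c)) \<le> \<delta> * (u\<^sup>2 + v\<^sup>2)"
      using \<delta> by (intro mult_left_mono) auto
    moreover have "2 * Phi (s * t) \<le> Phi (s * u) + Phi (s * v)"
      using Phi_step_ge[of \<delta> t] \<delta> t s(1) by (simp add: u_def v_def s_def[symmetric] mult.commute)
    ultimately have "2 * (h t + \<delta> * c) \<le> h u + h v"
      unfolding h_def distrib_left by linarith
    then have "(h t + \<delta> * c) / h Y \<le> ((h u + h v) / 2) / h Y"
      using hY by (intro divide_right_mono) auto
    then show ?thesis by (simp add: H \<kappa>_def c_def u_def v_def add_divide_distrib)
  qed
  \<comment> \<open>With \<open>n\<close> steps available the loss is either that of stopping below
    \<open>\<delta>\<close> or that of running out of steps. The latter is at most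
    \<open>1 - n * \<kappa>\<close>, because every step gains \<open>\<kappa>\<close>.\<close>
  have main: "attains f lam (H (f / sqrt lam) - max (H \<delta>) (1 - real n * \<kappa>))"
    if "0 \<le> f" "0 < lam" "f / sqrt lam \<le> Y" for n f lam
    using that
  proof (induction n arbitrary: f lam)
    case 0
    then show ?case using H_1[of "f / sqrt lam"] by (intro attains_const) auto
  next
    case (Suc n)
    define t where "t = f / sqrt lam"
    let ?q = "H t - max (H \<delta>) (1 - real (Suc n) * \<kappa>)"
    have t: "0 \<le> t" "t \<le> Y" "f = t * sqrt lam" using Suc.prems by (auto simp: t_def)
    \<comment> \<open>At ratio at least 1 the doubling jump succeeds; below \<open>\<delta>\<close>
      the step would make an average negative, so the construction stops; in between it takes the
      step \<open>\<delta> * sqrt lam\<close>.\<close>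
    consider "1 \<le> t" | "t < \<delta>" | "\<delta> \<le> t" "t < 1" by linarith
    then have "attains f lam ?q"
    proof cases
      case 1
      then have "lam \<le> f\<^sup>2" using Suc.prems by (simp add: t(3) power_mult_distrib)
      then have "attains f lam 1" using Suc.prems by (intro attains_1)
      moreover have "?q \<le> 1" using H_1[OF t(1,2)] H_0[of \<delta>] \<delta> by linarith
      ultimately show ?thesis by (rule attains_mono)
    next
      case 2
      then have "?q \<le> 0" using H_mono[of t \<delta>] t by linarith
      then show ?thesis using Suc.prems by (intro attains_const) auto
    next
      case 3
      define d where "d = \<delta> * sqrt lam"
      have lam': "lam - d\<^sup>2 = s\<^sup>2 * lam"
        using Suc.prems by (simp add: d_def power_mult_distrib s(2) algebra_simps)
      then have pos: "0 < lam - d\<^sup>2" using \<delta>2 s(2) Suc.prems by simp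
      have sqrt_lam': "sqrt (lam - d\<^sup>2) = s * sqrt lam"
        unfolding lam' using s(1) by (simp add: real_sqrt_mult)
      have e: "(f - d) / sqrt (lam - d\<^sup>2) = (t - \<delta>) / s" "(f + d) / sqrt (lam - d\<^sup>2) = (t + \<delta>) / s"
        using Suc.prems unfolding sqrt_lam'
        by (simp_all add: t(3) d_def left_diff_distrib[symmetric] distrib_right[symmetric])
      have le: "(t - \<delta>) / s \<le> Y" "(t + \<delta>) / s \<le> Y"
        unfolding Y_def using 3 s \<delta> by (auto intro!: divide_right_mono)
      have nonneg: "0 \<le> f - d" "0 \<le> f + d"
        using 3 \<delta> Suc.prems by (auto simp: t(3) d_def mult_right_mono)
      let ?M = "max (H \<delta>) (1 - real n * \<kappa>)"
      have "attains f lam ((H ((t - \<delta>) / s) - ?M + (H ((t + \<delta>) / s) - ?M)) / 2)"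
        using Suc.IH[OF nonneg(1) pos] Suc.IH[OF nonneg(2) pos] le unfolding e by (intro attains_step)
      moreover have "?q \<le> (H ((t - \<delta>) / s) - ?M + (H ((t + \<delta>) / s) - ?M)) / 2"
      proof -
        have M: "?M \<le> max (H \<delta>) (1 - real (Suc n) * \<kappa>) + \<kappa>"
          using \<kappa> by (auto simp: max_def algebra_simps)
        have "a - m' \<le> ((x - m) + (y - m)) / 2" if "m \<le> m' + b" "a + b \<le> (x + y) / 2" for a b m m' x y :: real
          using that by (simp add: field_simps)
        from this[OF M gain[OF 3(1)]] show ?thesis .
      qed
      ultimately show ?thesis by (rule attains_mono)
    qed
    then show ?case by (simp add: t_def)
  qed
  \<comment> \<open>Enough steps make the second term of the maximum negative, leaving
    \<open>H \<delta>\<close>.\<close>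
  obtain n where "1 < real n * \<kappa>" using reals_Archimedean3[OF \<kappa>] by blast
  then have n: "max (H \<delta>) (1 - real n * \<kappa>) = H \<delta>" using H_0[of \<delta>] \<delta> by (simp add: max_def)
  have lam: "0 < lam" using less_sqrt_imp_pos f by blast
  then have "f / sqrt lam \<le> Y" using f Y by (smt (verit) divide_le_eq_1 real_sqrt_gt_zero)
  with main[OF f(1) lam, of n] show ?thesis by (simp add: n)
qed

subsection \<open>The Bellman function\<close>

lemma bellman_M_bound:
  assumes "\<phi> \<in> admissible (dyadic_interval N k) f \<bar>f\<bar>" "0 \<le> f" "0 < lam"
  shows "measure lebesgue {x \<in> dyadic_interval N k. ennreal lam \<le> square_function_sq (dyadic_interval N k) \<phi> x}
     / measure lebesgue (dyadic_interval N k) \<le> bellman_val f lam"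
proof -
  have "integrable lebesgue \<phi>" "AE x in lebesgue. 0 \<le> \<phi> x" "average (dyadic_interval N k) \<phi> = f"
    using assms(1) admissible_nonneg[of "dyadic_interval N k" f] assms(2) by (auto simp: dyadic_intervals_def)
  with measure_square_function_le[of \<phi> lam N k] assms(3) show ?thesis
    by (simp add: measure_dyadic_interval field_simps)
qed

lemma bellman_M_ge:
  assumes "attains f lam q" "0 \<le> f" "0 < lam"
  shows "q \<le> bellman_M (dyadic_interval N k) f \<bar>f\<bar> lam"
proof -
  let ?J = "dyadic_interval N k"
  obtain \<phi> where \<phi>: "integrable lebesgue \<phi>" "\<forall>x. 0 \<le> \<phi> x" "\<forall>x. x \<notin> ?J \<longrightarrow> \<phi> x = 0" "average ?J \<phi> = f"
     "q * 2 powi N \<le> measure lebesgue {x \<in> ?J. ennreal lam \<le> square_function_sq ?J \<phi> x}"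
    by (rule attainsE[OF assms(1)])
  have "\<phi> \<in> admissible ?J f \<bar>f\<bar>"
    using \<phi> assms(2) by (simp add: admissible_def)
  moreover have "q \<le> measure lebesgue {x \<in> ?J. ennreal lam \<le> square_function_sq ?J \<phi> x} / measure lebesgue ?J"
    using \<phi>(5) by (simp add: measure_dyadic_interval field_simps)
  \<comment> \<open>A real supremum dominates its members only if they are bounded above; the upper
    bound supplies this.\<close>
  moreover have "bdd_above ((\<lambda>\<phi>. measure lebesgue {x \<in> ?J. ennreal lam \<le> square_function_sq ?J \<phi> x} / measure lebesgue ?J) ` admissible ?J f \<bar>f\<bar>)"
    using bellman_M_bound assms(2,3) by (intro bdd_aboveI2) blast
  ultimately show ?thesis unfolding bellman_M_def by (meson cSUP_upper order_trans)
qed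

lemma bellman_M_eq:
  assumes f: "0 \<le> f" and lam: "0 < lam"
  shows "bellman_M (dyadic_interval N k) f \<bar>f\<bar> lam = bellman_val f lam"
proof (rule antisym)
  let ?J = "dyadic_interval N k"
  \<comment> \<open>A constant function shows that the admissible class is nonempty, as the supremum
    bound requires.\<close>
  obtain \<phi> where "integrable lebesgue \<phi>" "\<forall>x. 0 \<le> \<phi> x" "\<forall>x. x \<notin> ?J \<longrightarrow> \<phi> x = 0" "average ?J \<phi> = f"
    by (rule attainsE[OF attains_const[OF f, of 0 lam]]) auto
  then have "\<phi> \<in> admissible ?J f \<bar>f\<bar>" using f by (simp add: admissible_def)
  then show "bellman_M ?J f \<bar>f\<bar> lam \<le> bellman_val f lam"
    unfolding bellman_M_def using bellman_M_bound f lam by (intro cSUP_least) auto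
  show "bellman_val f lam \<le> bellman_M ?J f \<bar>f\<bar> lam"
  proof (cases "f < sqrt lam")
    case False
    then have "lam \<le> f\<^sup>2" using lam by (simp add: not_less real_le_lsqrt sqrt_le_D)
    then show ?thesis using bellman_M_ge[OF attains_1[OF f] f lam] False by (simp add: bellman_val_def)
  next
    case True
    define t where "t = f / sqrt lam"
    define h where "h \<delta> y = Phi (sqrt (1 - \<delta>\<^sup>2) * y) + \<delta> * y\<^sup>2" for \<delta> y :: real
    let ?g = "\<lambda>\<delta>. h \<delta> t / h \<delta> ((1 + \<delta>) / sqrt (1 - \<delta>\<^sup>2)) - h \<delta> \<delta> / h \<delta> ((1 + \<delta>) / sqrt (1 - \<delta>\<^sup>2))"
    have "isCont Phi x" for x using continuous_on_Phi by (simp add: continuous_on_eq_continuous_at)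
    note tendsto_Phi = isCont_tendsto_compose[OF this]
    \<comment> \<open>As \<open>\<delta>\<close> tends to 0, the factor
      \<open>sqrt (1 - \<delta>^2)\<close> and the normalizing ratio tend to 1, while the quadratic
      term and the stopping loss vanish.\<close>
    have lim: "(?g \<longlongrightarrow> Phi t / Phi 1) (at_right 0)"
    proof -
      have "(?g \<longlongrightarrow> (Phi (sqrt (1 - 0\<^sup>2) * t) + 0 * t\<^sup>2) /
          (Phi (sqrt (1 - 0\<^sup>2) * ((1 + 0) / sqrt (1 - 0\<^sup>2))) + 0 * ((1 + 0) / sqrt (1 - 0\<^sup>2))\<^sup>2) -
          (Phi (sqrt (1 - 0\<^sup>2) * 0) + 0 * 0\<^sup>2) /
          (Phi (sqrt (1 - 0\<^sup>2) * ((1 + 0) / sqrt (1 - 0\<^sup>2))) + 0 * ((1 + 0) / sqrt (1 - 0\<^sup>2))\<^sup>2)) (at_right 0)"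
        unfolding h_def by (intro tendsto_intros tendsto_Phi) (use Phi_pos[of 1] in auto)
      then show ?thesis by simp
    qed
    have "eventually (\<lambda>\<delta>. ?g \<delta> \<le> bellman_M ?J f \<bar>f\<bar> lam) (at_right 0)"
      using eventually_at_right_real[of 0 "1::real", OF zero_less_one]
    proof (rule eventually_mono)
      fix \<delta> :: real assume "\<delta> \<in> {0<..<1}"
      then show "?g \<delta> \<le> bellman_M ?J f \<bar>f\<bar> lam"
        using attains_discrete[of \<delta> f lam] f True lam unfolding t_def h_def by (intro bellman_M_ge) auto
    qed
    then have "Phi t / Phi 1 \<le> bellman_M ?J f \<bar>f\<bar> lam"
      by (rule tendsto_upperbound[OF lim]) simp
    then show ?thesis using True by (simp add: bellman_val_def t_def)
  qed
qed

text \<open>Negation maps one admissible class onto the other and leaves the square function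
  unchanged; this reduces negative \<open>f\<close> to positive \<open>f\<close>.\<close>

lemma bellman_M_uminus: "bellman_M J (- f) F lam = bellman_M J f F lam"
proof -
  have avg: "average I (\<lambda>x. - \<phi> x) = - average I \<phi>" for I \<phi>
    unfolding average_def set_lebesgue_integral_def
    by (simp only: scaleR_minus_right Bochner_Integration.integral_minus minus_divide_left)
  have diff: "dyadic_diff I (\<lambda>x. - \<phi> x) x = - dyadic_diff I \<phi> x" for I \<phi> x
    by (simp add: dyadic_diff_def avg algebra_simps)
  have sq: "square_function_sq J (\<lambda>x. - \<phi> x) x = square_function_sq J \<phi> x" for \<phi> x
    by (simp add: square_function_sq_def diff)
  have adm: "(\<lambda>x. - \<phi> x) \<in> admissible J (- f) F" if "\<phi> \<in> admissible J f F" for f \<phi>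
    using that by (auto simp: admissible_def avg)
  have "admissible J (- f) F = (\<lambda>\<phi> x. - \<phi> x) ` admissible J f F"
  proof (intro equalityI subsetI)
    fix \<phi> assume "\<phi> \<in> admissible J (- f) F"
    then have "(\<lambda>x. - \<phi> x) \<in> admissible J f F" using adm[of \<phi> "- f"] by simp
    then show "\<phi> \<in> (\<lambda>\<phi> x. - \<phi> x) ` admissible J f F" by (rule rev_image_eqI) simp
  qed (use adm in auto)
  then show ?thesis by (simp add: bellman_M_def image_image sq)
qed

theorem theorem3p2:
  fixes f lam :: real and J :: "real set"
  assumes "J \<in> dyadic_intervals" and "lam > 0"
  shows "bellman_Mb J \<bar>f\<bar> lam = bellman_M J f \<bar>f\<bar> lam \<and>
         bellman_M J f \<bar>f\<bar> lam =
           (if \<bar>f\<bar> < sqrt lam then Phi (\<bar>f\<bar> / sqrt lam) / Phi 1 else 1) \<and>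
         (if \<bar>f\<bar> < sqrt lam then Phi (\<bar>f\<bar> / sqrt lam) / Phi 1 else 1) =
           min (Phi (\<bar>f\<bar> / sqrt lam) / Phi 1) 1"
proof -
  have "bellman_M J \<bar>f\<bar> \<bar>f\<bar> lam = bellman_val \<bar>f\<bar> lam"
    using assms bellman_M_eq[of "\<bar>f\<bar>" lam] by (auto simp: dyadic_intervals_def)
  moreover have "bellman_M J f \<bar>f\<bar> lam = bellman_M J \<bar>f\<bar> \<bar>f\<bar> lam"
    using bellman_M_uminus[of J f] by (cases "0 \<le> f") auto
  ultimately show ?thesis
    using bellman_val_eq_min[of "\<bar>f\<bar>" lam] assms(2) by (simp add: bellman_Mb_def bellman_val_def)
qed

end
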